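(* Let $p$ be a prime, $F$ a field of characteristic $p$, $n=2m$ with $m\ge 1$, and let $\mathfrak{a}(n)_p$ be any one of the Lie algebras $\mathfrak{h}(n)_p$, $\mathfrak{h}^{(2)}(n)_p$, $\mathfrak{po}(n)_p$, $\mathfrak{po}^{(2)}(n)_p$ over $F$, equipped with the symmetric grading. Then for all integers $k\ge 0$ and $g$ the cohomologies in opposite grades are isomorphic as $F$-vector spaces: $$H^k_{g}\left(\mathfrak{a}(n)_p\right)\cong H^k_{-g}\left(\mathfrak{a}(n)_p\right).$$
   Context: Divided powers. Let $x_1,\dots,x_n$ be indeterminates, $n=2m$. The divided power algebra over $F$ has basis $\mathbf{x}^{(\mathbf{r})}=x_1^{(r_1)}\cdots x_n^{(r_n)}$, $\mathbf{r}\in\mathbb{Z}_{\ge 0}^n$ (where $x_i^{(r)}$ plays the role of $x_i^r/r!$), with product $\mathbf{x}^{(\mathbf{r})}\mathbf{x}^{(\mathbf{s})}=\binom{\mathbf{r}+\mathbf{s}}{\mathbf{r}}\mathbf{x}^{(\mathbf{r}+\mathbf{s})}$, $\binom{\mathbf{r}+\mathbf{s}}{\mathbf{r}}=\prod_i\binom{r_i+s_i}{r_i}$, and derivations $\partial_i x_i^{(r)}=x_i^{(r-1)}$ (with $x_i^{(-1)}=0$), $\partial_i x_j^{(r)}=0$ for $j\ne i$. The Poisson bracket is $\{f,h\}=\sum_{i=1}^m(\partial_i f\,\partial_{i+m}h-\partial_{i+m}f\,\partial_i h)$, corresponding to the symplectic form $\omega=\sum_{i=1}^m dx_i\wedge dx_{i+m}$.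 Algebras. The truncated Poisson algebra is $$\mathfrak{po}(n)_p=\mathrm{span}\{\mathbf{x}^{(\mathbf{r})}\mid 0\le r_i<p\}\oplus\mathrm{span}\{x_1^{(p)},\dots,x_n^{(p)}\}$$ with the Poisson bracket (dimension $p^n+n$). The truncated Hamiltonian algebra $\mathfrak{h}(n)_p$ is its quotient by the central subspace of constants $F\cdot 1$, i.e. it has basis $\{\mathbf{x}^{(\mathbf{r})}\mid 0\le r_i<p,\ 0<\sum_i r_i\}\cup\{x_1^{(p)},\dots,x_n^{(p)}\}$ with the Poisson bracket taken modulo constants (dimension $p^n+n-1$). The algebra $\mathfrak{h}^{(2)}(n)_p$ is the subalgebra of $\mathfrak{h}(n)_p$ spanned by $\{\mathbf{x}^{(\mathbf{r})}\mid 0\le r_i<p,\ 0<\sum_i r_i<n(p-1)\}$ (dimension $p^n-2$). The algebra $\mathfrak{po}^{(2)}(n)_p$ is the corresponding Poisson algebra, i.e. the preimage of $\mathfrak{h}^{(2)}(n)_p$ in $\mathfrak{po}(n)_p$, spanned by $\{\mathbf{x}^{(\mathbf{r})}\mid 0\le r_i<p,\ 0\le\sum_i r_i<n(p-1)\}$. Symmetric grading. This is the $\mathbb{Z}$-grading induced by $\deg x_i=-1$ and $\deg x_{i+m}=1$ for $1\le i\le m$; thus $\mathbf{x}^{(\mathbf{r})}$ has grade $\sum_{i=1}^m(r_{i+m}-r_i)$. The bracket preserves this grading, so $\mathfrak{a}(n)_p=\bigoplus_i L_i$ is a $\mathbb{Z}$-graded Lie algebra. Graded cohomology. $C^k(\mathfrak{a})$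 denotes the space of alternating $k$-linear forms on $\mathfrak{a}$ with values in the trivial module $F$ (the dual of $\Lambda^k\mathfrak{a}$), with the Chevalley–Eilenberg differential. $C^k_g(\mathfrak{a})$ is the subspace of cochains vanishing on $L_{g_1}\times\cdots\times L_{g_k}$ whenever $g_1+\cdots+g_k\neq g$. For each $g$, $C^*_g(\mathfrak{a})$ is a subcomplex, and $H^k_g(\mathfrak{a})$ is its $k$-th cohomology. *)

theory Defs
  imports "HOL-Library.Poly_Mapping" "HOL-Computational_Algebra.Primes"
begin

section \<open>Vector spaces with explicit carrier\<close>

text \<open>
  The scalar field is a type of class \<^class>\<open>field\<close>. Carriers are explicit because quotient spaces
  and dimensions depending on a parameter are needed.
\<close>

record ('a, 'v) vspace =
  vcarrier :: "'v set"
  vzero :: 'v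
  vadd :: "'v \<Rightarrow> 'v \<Rightarrow> 'v"
  vscale :: "'a \<Rightarrow> 'v \<Rightarrow> 'v"

inductive_set vspan :: "('a, 'v, 'e) vspace_scheme \<Rightarrow> 'v set \<Rightarrow> 'v set"
  for V :: "('a, 'v, 'e) vspace_scheme" and S :: "'v set"
  where
    zero: "vzero V \<in> vspan V S"
  | base: "x \<in> S \<Longrightarrow> x \<in> vspan V S"
  | add: "x \<in> vspan V S \<Longrightarrow> y \<in> vspan V S \<Longrightarrow> vadd V x y \<in> vspan V S"
  | scale: "x \<in> vspan V S \<Longrightarrow> vscale V a x \<in> vspan V S"

definition vcoset :: "('a, 'v, 'e) vspace_scheme \<Rightarrow> 'v set \<Rightarrow> 'v \<Rightarrow> 'v set"
  where "vcoset V W x = {vadd V x w | w. w \<in> W}"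

text \<open>
  The quotient of \<open>V\<close> by a subspace \<open>W\<close>. In the scalar multiplication the summand \<open>w\<close> matters for
  \<open>a = 0\<close>, where the pointwise multiple of a coset is only the zero vector of \<open>V\<close>.
\<close>

definition vquotient :: "('a, 'v, 'e) vspace_scheme \<Rightarrow> 'v set \<Rightarrow> ('a, 'v set) vspace"
  where "vquotient V W =
    \<lparr>vcarrier = vcoset V W ` vcarrier V,
     vzero = W,
     vadd = (\<lambda>X Y. {vadd V x y | x y. x \<in> X \<and> y \<in> Y}),
     vscale = (\<lambda>a X. {vadd V (vscale V a x) w | x w. x \<in> X \<and> w \<in> W})\<rparr>"

definition visomorphic ::
    "('a, 'v, 'e) vspace_scheme \<Rightarrow> ('a, 'w, 'f) vspace_scheme \<Rightarrow> bool"
  where "visomorphic V W \<longleftrightarrow>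
    (\<exists>\<phi>. bij_betw \<phi> (vcarrier V) (vcarrier W) \<and>
      (\<forall>x\<in>vcarrier V. \<forall>y\<in>vcarrier V. \<phi> (vadd V x y) = vadd W (\<phi> x) (\<phi> y)) \<and>
      (\<forall>a. \<forall>x\<in>vcarrier V. \<phi> (vscale V a x) = vscale W a (\<phi> x)))"


section \<open>Graded Lie algebras\<close>

text \<open>\<open>component L i\<close> is the homogeneous component of grade \<open>i\<close>.\<close>

record ('a, 'v) graded_lie = "('a, 'v) vspace" +
  bracket :: "'v \<Rightarrow> 'v \<Rightarrow> 'v"
  component :: "int \<Rightarrow> 'v set"

text \<open>
  Intended for subalgebras \<open>U\<close> spanned by homogeneous elements and for homogeneous ideals \<open>I\<close>.
\<close>

definition lie_sub :: "('a, 'v) graded_lie \<Rightarrow> 'v set \<Rightarrow> ('a, 'v) graded_lie"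
  where "lie_sub L U = L\<lparr>vcarrier := U, component := (\<lambda>i. component L i \<inter> U)\<rparr>"

definition lie_quotient :: "('a, 'v) graded_lie \<Rightarrow> 'v set \<Rightarrow> ('a, 'v set) graded_lie"
  where "lie_quotient L I =
    vspace.extend (vquotient L I)
      (graded_lie.fields
        (\<lambda>X Y. {vadd L (bracket L x y) w | x y w. x \<in> X \<and> y \<in> Y \<and> w \<in> I})
        (\<lambda>i. vcoset L I ` component L i))"

lemma lie_quotient_simps [simp]:
  "vcarrier (lie_quotient L I) = vcoset L I ` vcarrier L"
  "vzero (lie_quotient L I) = I"
  "vadd (lie_quotient L I) X Y = {vadd L x y | x y. x \<in> X \<and> y \<in> Y}"
  "vscale (lie_quotient L I) a X = {vadd L (vscale L a x) w | x w. x \<in> X \<and> w \<in> I}"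
  "bracket (lie_quotient L I) X Y =
    {vadd L (bracket L x y) w | x y w. x \<in> X \<and> y \<in> Y \<and> w \<in> I}"
  "component (lie_quotient L I) i = vcoset L I ` component L i"
  by (simp_all add: lie_quotient_def vquotient_def vspace.defs graded_lie.defs)


section \<open>Graded cohomology with trivial coefficients\<close>

text \<open>
  A \<open>k\<close>-cochain takes the list of its \<open>k\<close> arguments. It is made zero on all lists that are not
  lists of \<open>k\<close> elements of the carrier, so that equality of cochains is equality of functions.
\<close>

definition args :: "('a, 'v, 'e) vspace_scheme \<Rightarrow> nat \<Rightarrow> 'v list set"
  where "args L k = {xs. length xs = k \<and> set xs \<subseteq> vcarrier L}"

definition cochains :: "('a::field, 'v) graded_lie \<Rightarrow> nat \<Rightarrow> ('v list \<Rightarrow> 'a) set"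
  where "cochains L k = {c.
    (\<forall>xs. xs \<notin> args L k \<longrightarrow> c xs = 0) \<and>
    (\<forall>xs\<in>args L k. \<forall>i<k. \<forall>x\<in>vcarrier L. \<forall>y\<in>vcarrier L.
      c (xs[i := vadd L x y]) = c (xs[i := x]) + c (xs[i := y])) \<and>
    (\<forall>xs\<in>args L k. \<forall>i<k. \<forall>a. \<forall>x\<in>vcarrier L.
      c (xs[i := vscale L a x]) = a * c (xs[i := x])) \<and>
    (\<forall>xs\<in>args L k. \<forall>i j. i < j \<and> j < k \<and> xs ! i = xs ! j \<longrightarrow> c xs = 0)}"

definition graded_cochains ::
    "('a::field, 'v) graded_lie \<Rightarrow> nat \<Rightarrow> int \<Rightarrow> ('v list \<Rightarrow> 'a) set"
  where "graded_cochains L k g = {c \<in> cochains L k.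
    \<forall>xs gs. length xs = k \<and> length gs = k \<and> (\<forall>i<k. xs ! i \<in> component L (gs ! i)) \<and>
      sum_list gs \<noteq> g \<longrightarrow> c xs = 0}"

definition ce_diff ::
    "('a::field, 'v) graded_lie \<Rightarrow> nat \<Rightarrow> ('v list \<Rightarrow> 'a) \<Rightarrow> 'v list \<Rightarrow> 'a"
  where "ce_diff L k c xs =
    (if xs \<in> args L (Suc k)
     then \<Sum>j\<le>k. \<Sum>i<j. (-1) ^ (i + j) * c (bracket L (xs ! i) (xs ! j) # nths xs (- {i, j}))
     else 0)"

definition graded_cocycles ::
    "('a::field, 'v) graded_lie \<Rightarrow> nat \<Rightarrow> int \<Rightarrow> ('v list \<Rightarrow> 'a) set"
  where "graded_cocycles L k g = {c \<in> graded_cochains L k g. ce_diff L k c = (\<lambda>_. 0)}"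

definition graded_coboundaries ::
    "('a::field, 'v) graded_lie \<Rightarrow> nat \<Rightarrow> int \<Rightarrow> ('v list \<Rightarrow> 'a) set"
  where "graded_coboundaries L k g =
    (case k of 0 \<Rightarrow> {\<lambda>_. 0} | Suc l \<Rightarrow> ce_diff L l ` graded_cochains L l g)"

definition graded_cohomology ::
    "('a::field, 'v) graded_lie \<Rightarrow> nat \<Rightarrow> int \<Rightarrow> ('a, ('v list \<Rightarrow> 'a) set) vspace"
  where "graded_cohomology L k g =
    vquotient
      \<lparr>vcarrier = graded_cocycles L k g,
       vzero = (\<lambda>_. 0),
       vadd = (\<lambda>c d xs. c xs + d xs),
       vscale = (\<lambda>a c xs. a * c xs)\<rparr>
      (graded_coboundaries L k g)"


section \<open>The divided power algebra and its Poisson bracket\<close>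

text \<open>
  A multi-index is a finitely supported function on the indices of the variables, and an element of
  the divided power algebra is a finitely supported family of coefficients. The ring structure that
  \<^type>\<open>poly_mapping\<close> carries in the library is the ordinary polynomial product and is not used.
\<close>

alias lookup = Poly_Mapping.lookup
alias keys = Poly_Mapping.keys

type_synonym multi_index = "nat \<Rightarrow>\<^sub>0 nat"
type_synonym 'a divpow = "multi_index \<Rightarrow>\<^sub>0 'a"

definition dmonom :: "multi_index \<Rightarrow> 'a::field divpow"
  where "dmonom r = Poly_Mapping.single r 1"

definition dscale :: "'a::field \<Rightarrow> 'a divpow \<Rightarrow> 'a divpow"
  where "dscale a f = Poly_Mapping.map ((*) a) f"

definition multi_binomial :: "multi_index \<Rightarrow> multi_index \<Rightarrow> nat"
  where "multi_binomial r s = (\<Prod>i\<in>keys r. lookup r i + lookup s i choose lookup r i)"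

definition dmult :: "'a::field divpow \<Rightarrow> 'a divpow \<Rightarrow> 'a divpow"
  where "dmult f h =
    (\<Sum>r\<in>keys f. \<Sum>s\<in>keys h.
      dscale (lookup f r * lookup h s * of_nat (multi_binomial r s)) (dmonom (r + s)))"

definition dderiv :: "nat \<Rightarrow> 'a::field divpow \<Rightarrow> 'a divpow"
  where "dderiv i f =
    (\<Sum>r\<in>keys f. if lookup r i = 0 then 0
      else dscale (lookup f r) (dmonom (r - Poly_Mapping.single i 1)))"

definition poisson :: "nat \<Rightarrow> 'a::field divpow \<Rightarrow> 'a divpow \<Rightarrow> 'a divpow"
  where "poisson m f h =
    (\<Sum>i=1..m. dmult (dderiv i f) (dderiv (i + m) h) - dmult (dderiv (i + m) f) (dderiv i h))"

lemma dmult_dmonom: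
  "dmult (dmonom r) (dmonom s) = dscale (of_nat (multi_binomial r s)) (dmonom (r + s))"
  by (simp add: dmult_def dmonom_def dscale_def)

lemma dderiv_dmonom:
  "dderiv i (dmonom r) =
    (if lookup r i = 0 then 0 else dmonom (r - Poly_Mapping.single i 1))"
  by (auto simp: dderiv_def dmonom_def dscale_def)

definition multi_indices :: "nat \<Rightarrow> multi_index set"
  where "multi_indices n = {r. keys r \<subseteq> {1..n}}"

definition symmetric_grade :: "nat \<Rightarrow> multi_index \<Rightarrow> int"
  where "symmetric_grade m r = (\<Sum>i=1..m. int (lookup r (i + m)) - int (lookup r i))"

text \<open>The full divided power algebra in \<open>2 * m\<close> variables with the symmetric grading.\<close>

definition divpow_lie :: "nat \<Rightarrow> ('a::field, 'a divpow) graded_lie"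
  where "divpow_lie m =
    \<lparr>vcarrier = {f. keys f \<subseteq> multi_indices (2 * m)},
     vzero = 0,
     vadd = (+),
     vscale = dscale,
     bracket = poisson m,
     component = (\<lambda>g. {f. keys f \<subseteq> {r \<in> multi_indices (2 * m). symmetric_grade m r = g}})\<rparr>"


section \<open>Truncated Poisson and Hamiltonian algebras\<close>

definition truncated_indices :: "nat \<Rightarrow> nat \<Rightarrow> multi_index set"
  where "truncated_indices n p = {r \<in> multi_indices n. \<forall>i\<in>{1..n}. lookup r i < p}"

definition total_degree :: "nat \<Rightarrow> multi_index \<Rightarrow> nat"
  where "total_degree n r = (\<Sum>i=1..n. lookup r i)"

definition po :: "nat \<Rightarrow> nat \<Rightarrow> ('a::field, 'a divpow) graded_lie"
  where "po m p = lie_sub (divpow_lie m)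
    (vspan (divpow_lie m)
      (dmonom ` truncated_indices (2 * m) p \<union>
       (\<lambda>i. dmonom (Poly_Mapping.single i p)) ` {1..2 * m}))"

definition constants :: "nat \<Rightarrow> 'a::field divpow set"
  where "constants m = vspan (divpow_lie m) {dmonom 0}"

definition ham :: "nat \<Rightarrow> nat \<Rightarrow> ('a::field, 'a divpow set) graded_lie"
  where "ham m p = lie_quotient (po m p) (constants m)"

definition po_to_ham :: "nat \<Rightarrow> nat \<Rightarrow> 'a::field divpow \<Rightarrow> 'a divpow set"
  where "po_to_ham m p = vcoset (po m p) (constants m)"

definition ham2 :: "nat \<Rightarrow> nat \<Rightarrow> ('a::field, 'a divpow set) graded_lie"
  where "ham2 m p = lie_sub (ham m p)
    (vspan (ham m p)
      ((\<lambda>r. po_to_ham m p (dmonom r)) `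
        {r \<in> truncated_indices (2 * m) p.
          0 < total_degree (2 * m) r \<and> total_degree (2 * m) r < 2 * m * (p - 1)}))"

definition po2 :: "nat \<Rightarrow> nat \<Rightarrow> ('a::field, 'a divpow) graded_lie"
  where "po2 m p = lie_sub (po m p)
    {f \<in> vcarrier (po m p). po_to_ham m p f \<in> vcarrier (ham2 m p)}"

end

theory Submission
  imports Defs
begin

text \<open>
  Exchanging \<open>x\<^sub>i\<close> with \<open>x\<^bsub>i+m\<^esub>\<close> reverses the symmetric grading but changes the sign of
  the Poisson bracket. Its negative is therefore an automorphism of the Lie algebra, and still
  reverses the grading. This involution preserves the constants and all the subalgebras in
  question, and pulling back cochains along it exchanges the complexes of grades \<open>g\<close> and \<open>-g\<close>.
\<close>

section \<open>Grade-reversing involutions\<close>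

lemma image_Collect_binary:
  assumes "\<And>x y. T (f x y) = f' (T x) (T y)"
  shows "T ` {f x y | x y. x \<in> X \<and> y \<in> Y} = {f' x y | x y. x \<in> T ` X \<and> y \<in> T ` Y}"
proof -
  have "T ` {f x y | x y. x \<in> X \<and> y \<in> Y} = {T (f x y) | x y. x \<in> X \<and> y \<in> Y}"
    by blast
  also have "\<dots> = {f' (T x) (T y) | x y. x \<in> X \<and> y \<in> Y}"
    by (simp add: assms)
  also have "\<dots> = {f' x y | x y. x \<in> T ` X \<and> y \<in> T ` Y}"
    by blast
  finally show ?thesis .
qed

text \<open>Serves the bracket of cosets in \<open>lie_quotient\<close>, which ranges over two
  representatives and an element of the ideal; the other coset operations bind only two
  variables.\<close>

lemma image_Collect_ternary:
  assumes "\<And>x y z. T (f x y z) = f' (T x) (T y) (T z)"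
  shows "T ` {f x y z | x y z. x \<in> X \<and> y \<in> Y \<and> z \<in> Z} =
    {f' x y z | x y z. x \<in> T ` X \<and> y \<in> T ` Y \<and> z \<in> T ` Z}"
proof -
  have "T ` {f x y z | x y z. x \<in> X \<and> y \<in> Y \<and> z \<in> Z} =
      {T (f x y z) | x y z. x \<in> X \<and> y \<in> Y \<and> z \<in> Z}"
    by blast
  also have "\<dots> = {f' (T x) (T y) (T z) | x y z. x \<in> X \<and> y \<in> Y \<and> z \<in> Z}"
    by (simp add: assms)
  also have "\<dots> = {f' x y z | x y z. x \<in> T ` X \<and> y \<in> T ` Y \<and> z \<in> T ` Z}"
    by blast
  finally show ?thesis .
qed

lemma image_vcoset:
  assumes "\<And>x y. T (vadd V x y) = vadd V' (T x) (T y)"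
  shows "T ` vcoset V W x = vcoset V' (T ` W) (T x)"
  using image_Collect_binary[of T "vadd V" "vadd V'" "{x}" W, OF assms]
  by (simp add: vcoset_def)

text \<open>The isomorphism takes images of cosets under \<open>T\<close>, so no representatives are
  chosen. It is injective because taking images twice under an involution gives back every
  set.\<close>

lemma visomorphic_vquotient_involution:
  assumes inv: "\<And>x. T (T x) = x"
    and add: "\<And>x y. T (vadd V x y) = vadd V' (T x) (T y)"
    and scale: "\<And>a x. T (vscale V a x) = vscale V' a (T x)"
    and carrier: "T ` vcarrier V = vcarrier V'"
    and sub: "T ` W = W'"
  shows "visomorphic (vquotient V W) (vquotient V' W')"
proof -
  have coset: "T ` vcoset V W x = vcoset V' W' (T x)" for x
    using image_vcoset[of T V V', OF add] sub by simp
  have inj: "inj ((`) T)"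
    by (rule inj_on_inverseI[where g = "(`) T"]) (simp add: image_image inv)
  have "bij_betw ((`) T) (vcarrier (vquotient V W)) (vcarrier (vquotient V' W'))"
    unfolding bij_betw_def
  proof
    show "inj_on ((`) T) (vcarrier (vquotient V W))"
      using inj inj_on_subset by blast
    show "(`) T ` vcarrier (vquotient V W) = vcarrier (vquotient V' W')"
      by (simp add: vquotient_def image_image coset carrier[symmetric])
  qed
  moreover have "T ` vadd (vquotient V W) X Y = vadd (vquotient V' W') (T ` X) (T ` Y)" for X Y
    using image_Collect_binary[of T "vadd V" "vadd V'", OF add] by (simp add: vquotient_def)
  moreover have "T ` vscale (vquotient V W) a X = vscale (vquotient V' W') a (T ` X)" for a X
    using image_Collect_binary[of T "\<lambda>x. vadd V (vscale V a x)" "\<lambda>x. vadd V' (vscale V' a x)" X W]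
    by (simp add: vquotient_def add scale sub)
  ultimately show ?thesis
    unfolding visomorphic_def by blast
qed

text \<open>The identities are imposed on the whole type, not just on the carrier. They therefore
  restrict to any invariant subset, and they lift to operations on arbitrary sets, as the coset
  operations demand.\<close>

locale grade_reversal =
  fixes L :: "('a::field, 'v) graded_lie" and \<theta> :: "'v \<Rightarrow> 'v"
  assumes involution [simp]: "\<theta> (\<theta> x) = x"
    and carrier_closed: "x \<in> vcarrier L \<Longrightarrow> \<theta> x \<in> vcarrier L"
    and map_zero: "\<theta> (vzero L) = vzero L"
    and map_add: "\<theta> (vadd L x y) = vadd L (\<theta> x) (\<theta> y)"
    and map_scale: "\<theta> (vscale L a x) = vscale L a (\<theta> x)"
    and map_bracket: "\<theta> (bracket L x y) = bracket L (\<theta> x) (\<theta> y)"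
    and map_component: "x \<in> component L i \<Longrightarrow> \<theta> x \<in> component L (- i)"
begin

lemma image_eq: "\<theta> ` U = U" if "\<And>x. x \<in> U \<Longrightarrow> \<theta> x \<in> U"
  using that by (auto simp: image_iff) (metis involution)

text \<open>Generators may be sent anywhere into the span: \<open>reversal\<close> sends a monomial
  to the negative of a monomial, not to a generator.\<close>

lemma map_vspan: "\<theta> x \<in> vspan L S" if "x \<in> vspan L S" "\<And>x. x \<in> S \<Longrightarrow> \<theta> x \<in> vspan L S"
  using that(1)
  by induction (simp_all add: map_zero map_add map_scale vspan.zero vspan.add vspan.scale that(2))

lemma map_vcoset: "\<theta> ` vcoset L I x = vcoset L I (\<theta> x)" if "\<theta> ` I = I"
  using image_vcoset[of \<theta> L L, OF map_add] that by simp

lemma map_in_args_iff: "map \<theta> xs \<in> args L k \<longleftrightarrow> xs \<in> args L k"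
proof -
  have "\<theta> x \<in> vcarrier L \<longleftrightarrow> x \<in> vcarrier L" for x
    using carrier_closed[of x] carrier_closed[of "\<theta> x"] by auto
  then show ?thesis
    by (auto simp: args_def)
qed

section \<open>Pullback of cochains and its effect on graded cohomology\<close>

definition pullback :: "('v list \<Rightarrow> 'a) \<Rightarrow> 'v list \<Rightarrow> 'a"
  where "pullback c xs = c (map \<theta> xs)"

lemma pullback_pullback [simp]: "pullback (pullback c) = c"
  by (simp add: pullback_def fun_eq_iff comp_def)

lemma pullback_cochains: "pullback c \<in> cochains L k" if "c \<in> cochains L k"
proof -
  have "pullback c xs = 0" if "xs \<in> args L k" "i < j" "j < k" "xs ! i = xs ! j" for xs i j
  proof -
    have "map \<theta> xs \<in> args L k" "map \<theta> xs ! i = map \<theta> xs ! j"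
      using that by (simp add: map_in_args_iff) (use that in \<open>simp add: args_def\<close>)
    then show ?thesis
      using \<open>c \<in> _\<close> \<open>i < j\<close> \<open>j < k\<close> unfolding cochains_def pullback_def by blast
  qed
  moreover have "map \<theta> xs \<in> args L k" if "xs \<in> args L k" for xs
    using that by (simp add: map_in_args_iff)
  \<comment> \<open>Multilinearity remains: mapping over an updated list updates the mapped list at
    the same position, so additivity and homogeneity of \<open>c\<close> apply there.\<close>
  ultimately show ?thesis
    using that
    by (simp add: cochains_def)
      (simp add: pullback_def map_update map_add map_scale carrier_closed map_in_args_iff, blast)
qed

text \<open>Arguments of grades \<open>gs\<close> are moved to grades \<open>map uminus gs\<close>;
  if the former do not sum to \<open>- g\<close>, the latter do not sum to \<open>g\<close>, and
  \<open>c\<close> vanishes there.\<close>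

lemma pullback_graded_cochains:
  assumes "c \<in> graded_cochains L k g"
  shows "pullback c \<in> graded_cochains L k (- g)"
  unfolding graded_cochains_def
proof (intro CollectI conjI allI impI)
  show "pullback c \<in> cochains L k"
    using assms by (simp add: graded_cochains_def pullback_cochains)
next
  fix xs gs
  assume *: "length xs = k \<and> length gs = k \<and> (\<forall>i<k. xs ! i \<in> component L (gs ! i)) \<and>
    sum_list gs \<noteq> - g"
  have "sum_list (map uminus gs) = - sum_list gs"
    by (induction gs) auto
  then have "sum_list (map uminus gs) \<noteq> g"
    using * by auto
  moreover have "\<forall>i<k. map \<theta> xs ! i \<in> component L (map uminus gs ! i)"
    using * by (simp add: map_component)
  moreover have "length (map \<theta> xs) = k" "length (map uminus gs) = k"
    using * by auto
  ultimately show "pullback c xs = 0"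
    using assms unfolding graded_cochains_def pullback_def by blast
qed

text \<open>The differential is built from brackets and deletions of arguments only;
  \<open>\<theta>\<close> respects the former, and mapping over a list commutes with the
  latter.\<close>

lemma ce_diff_pullback: "ce_diff L k (pullback c) = pullback (ce_diff L k c)"
proof
  fix xs
  \<comment> \<open>Membership in \<open>args\<close> fixes the length \<open>Suc k\<close>, so both
    indices are in range and \<open>nth\<close> commutes with \<open>map\<close>.\<close>
  have "pullback c (bracket L (xs ! i) (xs ! j) # nths xs (- {i, j})) =
      c (bracket L (map \<theta> xs ! i) (map \<theta> xs ! j) # nths (map \<theta> xs) (- {i, j}))"
    if "xs \<in> args L (Suc k)" "i < j" "j \<le> k" for i j
    using that by (simp add: pullback_def map_bracket nths_map args_def)
  then show "ce_diff L k (pullback c) xs = pullback (ce_diff L k c) xs"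
    by (simp add: pullback_def[of "ce_diff L k c"] ce_diff_def map_in_args_iff)
qed

lemma pullback_graded_cocycles:
  assumes "c \<in> graded_cocycles L k g"
  shows "pullback c \<in> graded_cocycles L k (- g)"
proof -
  have "pullback (\<lambda>_. 0) = (\<lambda>_. 0)"
    by (simp add: pullback_def fun_eq_iff)
  then show ?thesis
    using assms by (simp add: graded_cocycles_def pullback_graded_cochains ce_diff_pullback)
qed

text \<open>In positive degree the primitive is pulled back along with the coboundary; in degree 0
  the only coboundary is the zero function.\<close>

lemma pullback_graded_coboundaries:
  assumes "c \<in> graded_coboundaries L k g"
  shows "pullback c \<in> graded_coboundaries L k (- g)"
  using assms pullback_graded_cochains
  by (cases k) (auto simp: graded_coboundaries_def simp flip: ce_diff_pullback,
      auto simp: pullback_def)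

theorem visomorphic_graded_cohomology:
  "visomorphic (graded_cohomology L k g) (graded_cohomology L k (- g))"
proof -
  \<comment> \<open>\<open>A\<close> stands for the cocycles and for the coboundaries. Closure used
    at \<open>- g\<close> gives the reverse inclusion, since \<open>pullback\<close> is its own
    inverse.\<close>
  have image: "pullback ` A g = A (- g)"
    if "\<And>c h. c \<in> A h \<Longrightarrow> pullback c \<in> A (- h)" for A :: "int \<Rightarrow> ('v list \<Rightarrow> 'a) set"
  proof
    show "pullback ` A g \<subseteq> A (- g)"
      using that by blast
    show "A (- g) \<subseteq> pullback ` A g"
    proof
      fix c
      assume "c \<in> A (- g)"
      then have "pullback c \<in> A g"
        using that[of c "- g"] by simp
      then show "c \<in> pullback ` A g"
        by (metis imageI pullback_pullback)
    qed
  qed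
  show ?thesis
    unfolding graded_cohomology_def
    by (rule visomorphic_vquotient_involution[where T = pullback])
      (simp_all add: image pullback_graded_cocycles pullback_graded_coboundaries,
        simp_all add: pullback_def fun_eq_iff)
qed

section \<open>Inheritance by subalgebras and quotients\<close>

lemma grade_reversal_lie_sub:
  assumes "\<And>x. x \<in> U \<Longrightarrow> \<theta> x \<in> U"
  shows "grade_reversal (lie_sub L U) \<theta>"
  by standard
    (auto simp: lie_sub_def assms map_zero map_add map_scale map_bracket map_component)

text \<open>An involution preserving \<open>I\<close> sends the coset of \<open>x\<close> to the
  coset of \<open>\<theta> x\<close>, so taking images induces it on the quotient.\<close>

lemma grade_reversal_lie_quotient:
  assumes I: "\<theta> ` I = I"
  shows "grade_reversal (lie_quotient L I) ((`) \<theta>)"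
proof
  show "\<theta> ` \<theta> ` X = X" for X
    by (simp add: image_image)
  show "\<theta> ` X \<in> vcarrier (lie_quotient L I)" if "X \<in> vcarrier (lie_quotient L I)" for X
    using that carrier_closed by (auto simp: map_vcoset I)
  show "\<theta> ` vzero (lie_quotient L I) = vzero (lie_quotient L I)"
    by (simp add: I)
  show "\<theta> ` vadd (lie_quotient L I) X Y = vadd (lie_quotient L I) (\<theta> ` X) (\<theta> ` Y)" for X Y
    using image_Collect_binary[of \<theta> "vadd L" "vadd L", OF map_add] by simp
  show "\<theta> ` vscale (lie_quotient L I) a X = vscale (lie_quotient L I) a (\<theta> ` X)" for a X
    using image_Collect_binary[of \<theta> "\<lambda>x. vadd L (vscale L a x)" "\<lambda>x. vadd L (vscale L a x)" X I]
    by (simp add: map_add map_scale I)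
  show "\<theta> ` bracket (lie_quotient L I) X Y = bracket (lie_quotient L I) (\<theta> ` X) (\<theta> ` Y)" for X Y
    using image_Collect_ternary[of \<theta> "\<lambda>x y. vadd L (bracket L x y)"
        "\<lambda>x y. vadd L (bracket L x y)" X Y I]
    by (simp add: map_add map_bracket I)
  show "\<theta> ` X \<in> component (lie_quotient L I) (- i)" if "X \<in> component (lie_quotient L I) i" for X i
    using that map_component by (auto simp: map_vcoset I)
qed

end


section \<open>Exchanging conjugate variables\<close>

text \<open>Fixing the indices outside \<open>{1..2 * m}\<close> makes this an involution of all
  natural numbers, hence injective, as the use of \<open>map_key\<close> requires.\<close>

definition swap_index :: "nat \<Rightarrow> nat \<Rightarrow> nat"
  where "swap_index m i =
    (if i \<in> {1..m} then i + m else if i \<in> {m + 1..2 * m} then i - m else i)"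

lemma swap_index_involution [simp]: "swap_index m (swap_index m i) = i"
  by (auto simp: swap_index_def)

lemma inj_swap_index [simp]: "inj (swap_index m)"
  by (rule inj_on_inverseI[where g = "swap_index m"]) simp

lemma swap_index_in_iff [simp]: "swap_index m i \<in> {1..2 * m} \<longleftrightarrow> i \<in> {1..2 * m}"
  by (auto simp: swap_index_def)

text \<open>\<open>map_key\<close> precomposes with the index map; for an involution this is the
  same as relabelling the variables by it.\<close>

definition swap_multi_index :: "nat \<Rightarrow> multi_index \<Rightarrow> multi_index"
  where "swap_multi_index m = Poly_Mapping.map_key (swap_index m)"

lemma lookup_swap_multi_index [simp]:
  "lookup (swap_multi_index m r) i = lookup r (swap_index m i)"
  by (simp add: swap_multi_index_def map_key.rep_eq)

lemma swap_multi_index_involution [simp]: "swap_multi_index m (swap_multi_index m r) = r"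
  by (rule poly_mapping_eqI) simp

lemma inj_swap_multi_index [simp]: "inj (swap_multi_index m)"
  by (rule inj_on_inverseI[where g = "swap_multi_index m"]) simp

lemma swap_multi_index_zero [simp]: "swap_multi_index m 0 = 0"
  by (rule poly_mapping_eqI) simp

lemma swap_multi_index_add:
  "swap_multi_index m (r + s) = swap_multi_index m r + swap_multi_index m s"
  by (rule poly_mapping_eqI) (simp add: lookup_add)

lemma swap_multi_index_diff:
  "swap_multi_index m (r - s) = swap_multi_index m r - swap_multi_index m s"
  by (rule poly_mapping_eqI) (simp add: lookup_minus)

lemma swap_multi_index_single:
  "swap_multi_index m (Poly_Mapping.single i a) = Poly_Mapping.single (swap_index m i) a"
  by (rule poly_mapping_eqI) (auto simp: lookup_single when_def)

lemma multi_binomial_swap: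
  "multi_binomial (swap_multi_index m r) (swap_multi_index m s) = multi_binomial r s"
  unfolding multi_binomial_def
  by (rule prod.reindex_bij_witness[where i = "swap_index m" and j = "swap_index m"])
    (auto simp: in_keys_iff)

lemma swap_in_multi_indices:
  "swap_multi_index m r \<in> multi_indices (2 * m)" if "r \<in> multi_indices (2 * m)"
proof -
  have "i \<in> {1..2 * m}" if "i \<in> keys (swap_multi_index m r)" for i
  proof -
    have "swap_index m i \<in> keys r"
      using that by (simp add: in_keys_iff)
    then show ?thesis
      using \<open>r \<in> _\<close> by (metis multi_indices_def mem_Collect_eq subsetD swap_index_in_iff)
  qed
  then show ?thesis
    by (auto simp: multi_indices_def)
qed

lemma swap_in_truncated_indices:
  "swap_multi_index m r \<in> truncated_indices (2 * m) p" if "r \<in> truncated_indices (2 * m) p"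
  \<comment> \<open>The deleted simp rules would unfold membership in \<open>{1..2 * m}\<close> and
    hide the pattern of \<open>swap_index_in_iff\<close>.\<close>
  using that swap_in_multi_indices[of r m] swap_index_in_iff[of m]
  unfolding truncated_indices_def by (simp del: atLeastAtMost_iff One_nat_def)

lemma total_degree_swap: "total_degree (2 * m) (swap_multi_index m r) = total_degree (2 * m) r"
  unfolding total_degree_def
  by (rule sum.reindex_bij_witness[where i = "swap_index m" and j = "swap_index m"])
    (simp_all del: atLeastAtMost_iff One_nat_def)

text \<open>The exponents at \<open>i\<close> and \<open>i + m\<close> trade places, so every
  summand changes sign.\<close>

lemma symmetric_grade_swap: "symmetric_grade m (swap_multi_index m r) = - symmetric_grade m r"
  unfolding symmetric_grade_def sum_negf[symmetric]
  by (rule sum.cong) (auto simp: swap_index_def)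


section \<open>The involution of the divided power algebra\<close>

lemma lookup_dscale [simp]: "lookup (dscale a f) r = a * lookup f r"
  by (simp add: dscale_def map.rep_eq when_def)

definition swap_divpow :: "nat \<Rightarrow> 'a::field divpow \<Rightarrow> 'a divpow"
  where "swap_divpow m = Poly_Mapping.map_key (swap_multi_index m)"

lemma lookup_swap_divpow [simp]: "lookup (swap_divpow m f) r = lookup f (swap_multi_index m r)"
  by (simp add: swap_divpow_def map_key.rep_eq)

lemma swap_divpow_involution [simp]: "swap_divpow m (swap_divpow m f) = f"
  by (rule poly_mapping_eqI) simp

lemma swap_divpow_zero [simp]: "swap_divpow m 0 = 0"
  by (rule poly_mapping_eqI) simp

lemma swap_divpow_add: "swap_divpow m (f + h) = swap_divpow m f + swap_divpow m h"
  by (rule poly_mapping_eqI) (simp add: lookup_add)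

lemma swap_divpow_uminus: "swap_divpow m (- f) = - swap_divpow m f"
  by (rule poly_mapping_eqI) simp

lemma swap_divpow_diff: "swap_divpow m (f - h) = swap_divpow m f - swap_divpow m h"
  by (rule poly_mapping_eqI) (simp add: lookup_minus)

lemma swap_divpow_sum: "swap_divpow m (sum f A) = (\<Sum>x\<in>A. swap_divpow m (f x))"
  by (induction A rule: infinite_finite_induct) (simp_all add: swap_divpow_add)

lemma swap_divpow_dscale: "swap_divpow m (dscale a f) = dscale a (swap_divpow m f)"
  by (rule poly_mapping_eqI) simp

lemma swap_divpow_dmonom: "swap_divpow m (dmonom r) = dmonom (swap_multi_index m r)"
  by (rule poly_mapping_eqI) (auto simp: dmonom_def lookup_single when_def)

text \<open>Renaming variables renames the derivation. The sums run over the keys of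
  \<open>f\<close> and of its image, which the involution matches bijectively.\<close>

lemma swap_divpow_dderiv: "swap_divpow m (dderiv i f) = dderiv (swap_index m i) (swap_divpow m f)"
  unfolding dderiv_def swap_divpow_sum
  by (rule sum.reindex_bij_witness[where i = "swap_multi_index m" and j = "swap_multi_index m"])
    (auto simp: in_keys_iff swap_divpow_dscale swap_divpow_dmonom swap_multi_index_diff
      swap_multi_index_single)

lemma swap_divpow_dmult: "swap_divpow m (dmult f h) = dmult (swap_divpow m f) (swap_divpow m h)"
proof -
  \<comment> \<open>The double sum is reindexed one variable at a time: here \<open>s\<close> for
    fixed \<open>r\<close>, then \<open>r\<close>. The binomial coefficient is invariant when both
    exponents are swapped.\<close>
  have inner: "(\<Sum>s\<in>keys h. swap_divpow m
        (dscale (lookup f r * lookup h s * of_nat (multi_binomial r s)) (dmonom (r + s)))) =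
      (\<Sum>s\<in>keys (swap_divpow m h). dscale (lookup f r * lookup (swap_divpow m h) s *
        of_nat (multi_binomial (swap_multi_index m r) s)) (dmonom (swap_multi_index m r + s)))" for r
    by (rule sum.reindex_bij_witness[where i = "swap_multi_index m" and j = "swap_multi_index m"])
      (auto simp: in_keys_iff swap_divpow_dscale swap_divpow_dmonom swap_multi_index_add
        multi_binomial_swap)
  show ?thesis
    unfolding dmult_def swap_divpow_sum inner
    by (rule sum.reindex_bij_witness[where i = "swap_multi_index m" and j = "swap_multi_index m"])
      (auto simp: in_keys_iff)
qed

text \<open>The exchange is antisymplectic: it interchanges the derivations by \<open>i\<close> and
  \<open>i + m\<close>, hence the two terms of each summand of the bracket.\<close>

lemma swap_divpow_poisson:
  "swap_divpow m (poisson m f h) = - poisson m (swap_divpow m f) (swap_divpow m h)"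
proof -
  have "swap_index m i = i + m" "swap_index m (i + m) = i" if "i \<in> {1..m}" for i
    using that by (auto simp: swap_index_def)
  then show ?thesis
    by (simp add: poisson_def swap_divpow_sum swap_divpow_diff swap_divpow_dmult
        swap_divpow_dderiv flip: sum_negf)
qed

section \<open>Signs, and the negated exchange as a Lie automorphism\<close>

lemma keys_uminus: "keys (- f) = keys f" for f :: "'b \<Rightarrow>\<^sub>0 'c::ab_group_add"
  by (auto simp: in_keys_iff)

lemma dderiv_uminus: "dderiv i (- f) = - dderiv i f"
proof -
  have "dscale (- a) h = - dscale a h" for a and h :: "'a divpow"
    by (rule poly_mapping_eqI) simp
  then show ?thesis
    by (auto simp: dderiv_def keys_uminus simp flip: sum_negf intro!: sum.cong)
qed

lemma dmult_uminus_uminus: "dmult (- f) (- h) = dmult f h"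
  by (simp add: dmult_def keys_uminus)

text \<open>The two signs cancel. Writing S for the exchange, this gives -S{f,h} = {Sf,Sh} =
  {-Sf,-Sh}, so -S respects the bracket.\<close>

lemma poisson_uminus_uminus: "poisson m (- f) (- h) = poisson m f h"
  by (simp add: poisson_def dderiv_uminus dmult_uminus_uminus)

definition reversal :: "nat \<Rightarrow> 'a::field divpow \<Rightarrow> 'a divpow"
  where "reversal m f = - swap_divpow m f"

text \<open>The sign is written as a scalar multiple so that closure of spans under scaling and
  \<open>po_to_ham_dscale\<close> apply directly.\<close>

lemma reversal_dmonom: "reversal m (dmonom r) = dscale (- 1) (dmonom (swap_multi_index m r))"
  by (rule poly_mapping_eqI) (simp add: reversal_def swap_divpow_dmonom)

lemma keys_reversal_iff: "r \<in> keys (reversal m f) \<longleftrightarrow> swap_multi_index m r \<in> keys f"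
  by (simp add: reversal_def in_keys_iff)

lemma grade_reversal_divpow_lie:
  "grade_reversal (divpow_lie m :: ('a::field, 'a divpow) graded_lie) (reversal m)"
proof
  show "reversal m x \<in> vcarrier (divpow_lie m)" if "x \<in> vcarrier (divpow_lie m)"
    for x :: "'a divpow"
    using that
    by (auto simp: divpow_lie_def keys_reversal_iff)
      (metis subsetD swap_in_multi_indices swap_multi_index_involution)
  show "reversal m x \<in> component (divpow_lie m) (- i)" if "x \<in> component (divpow_lie m) i"
    for x :: "'a divpow" and i
  proof -
    \<comment> \<open>The keys of the image are the swapped keys of \<open>x\<close>, so index range
      and grade are read off from the swapped exponent.\<close>
    have "r \<in> multi_indices (2 * m) \<and> symmetric_grade m r = - i" if "r \<in> keys (reversal m x)" for r
    proof -
      have "swap_multi_index m r \<in> multi_indices (2 * m)"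
        "symmetric_grade m (swap_multi_index m r) = i"
        using \<open>x \<in> _\<close> that by (auto simp: divpow_lie_def keys_reversal_iff)
      then show ?thesis
        using swap_in_multi_indices[of "swap_multi_index m r" m] by (auto simp: symmetric_grade_swap)
    qed
    then show ?thesis
      by (auto simp: divpow_lie_def)
  qed
  show "reversal m (vscale (divpow_lie m) a x) = vscale (divpow_lie m) a (reversal m x)"
    for a and x :: "'a divpow"
    by (rule poly_mapping_eqI) (simp add: divpow_lie_def reversal_def)
qed (simp_all add: divpow_lie_def reversal_def swap_divpow_add swap_divpow_uminus
    swap_divpow_poisson poisson_uminus_uminus)


section \<open>The truncated algebras\<close>

lemma grade_reversal_po: "grade_reversal (po m p :: ('a::field, 'a divpow) graded_lie) (reversal m)"
proof -
  let ?D = "divpow_lie m :: ('a, 'a divpow) graded_lie"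
  interpret D: grade_reversal ?D "reversal m"
    by (rule grade_reversal_divpow_lie)
  \<comment> \<open>Collecting the exponents of both families of generators reduces the claim to
    invariance of \<open>R\<close>: the truncated box is symmetric, and the divided powers of
    exponent \<open>p\<close> are permuted.\<close>
  define R where "R = truncated_indices (2 * m) p \<union> (\<lambda>i. Poly_Mapping.single i p) ` {1..2 * m}"
  define S :: "'a divpow set" where "S = dmonom ` R"
  have S: "dmonom ` truncated_indices (2 * m) p \<union>
      (\<lambda>i. dmonom (Poly_Mapping.single i p)) ` {1..2 * m} = S"
    by (simp add: S_def R_def image_Un image_image)
  have swap: "swap_multi_index m r \<in> R" if "r \<in> R" for r
    using that unfolding R_def
    by (auto simp: swap_multi_index_single swap_in_truncated_indices
        simp del: atLeastAtMost_iff One_nat_def)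
  have base: "reversal m x \<in> vspan ?D S" if "x \<in> S" for x
  proof -
    obtain r where x: "x = dmonom r" and r: "r \<in> R"
      using \<open>x \<in> S\<close> unfolding S_def by blast
    have "vscale ?D (- 1) (dmonom (swap_multi_index m r)) \<in> vspan ?D S"
      unfolding S_def by (intro vspan.scale vspan.base imageI swap r)
    then show ?thesis
      by (simp add: x reversal_dmonom divpow_lie_def)
  qed
  show ?thesis
    unfolding po_def S by (intro D.grade_reversal_lie_sub D.map_vspan[OF _ base])
qed

text \<open>The exponent 0 is fixed by the swap, so 1 is sent to -1.\<close>

lemma reversal_constants: "reversal m ` (constants m :: 'a::field divpow set) = constants m"
proof -
  let ?D = "divpow_lie m :: ('a, 'a divpow) graded_lie"
  interpret D: grade_reversal ?D "reversal m"
    by (rule grade_reversal_divpow_lie)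
  have "vscale ?D (- 1) (dmonom 0) \<in> vspan ?D {dmonom 0}"
    by (intro vspan.scale vspan.base) simp
  then have base: "reversal m x \<in> vspan ?D {dmonom 0}" if "x \<in> {dmonom 0}" for x
    using that by (simp add: reversal_dmonom divpow_lie_def)
  show ?thesis
    unfolding constants_def by (intro D.image_eq D.map_vspan[OF _ base])
qed

lemma grade_reversal_ham:
  "grade_reversal (ham m p :: ('a::field, 'a divpow set) graded_lie) ((`) (reversal m))"
  unfolding ham_def
  by (intro grade_reversal.grade_reversal_lie_quotient grade_reversal_po reversal_constants)

text \<open>Equivariance of the projection, by which invariance is carried between the Poisson and
  Hamiltonian algebras.\<close>

lemma reversal_po_to_ham: "reversal m ` po_to_ham m p f = po_to_ham m p (reversal m f)"
  unfolding po_to_ham_def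
  by (intro grade_reversal.map_vcoset grade_reversal_po reversal_constants)

text \<open>The quotient scales every \<open>f + c\<close> and then adds another constant
  \<open>w\<close>. Since \<open>dscale a c + w\<close> is again a constant, and
  \<open>c = 0\<close> is allowed, exactly the coset of \<open>dscale a f\<close> results, also for
  \<open>a = 0\<close>.\<close>

lemma po_to_ham_dscale:
  "po_to_ham m p (dscale a f) = vscale (ham m p) a (po_to_ham m p f)"
proof -
  have ops: "vadd (po m p) = (+)" "vscale (po m p) = dscale"
    by (simp_all add: po_def lie_sub_def divpow_lie_def)
  have zero: "0 \<in> constants m"
    using vspan.zero[of "divpow_lie m"] by (simp add: constants_def divpow_lie_def)
  have closed: "dscale a c + w \<in> constants m" if "c \<in> constants m" "w \<in> constants m" for c w
    using vspan.add[OF vspan.scale[of c "divpow_lie m" _ a], of "{dmonom 0}" w] that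
    by (simp add: constants_def divpow_lie_def)
  have distrib: "dscale a (f + c) + w = dscale a f + (dscale a c + w)" for c w
    by (rule poly_mapping_eqI) (simp add: lookup_add distrib_left)
  have "{dscale a f + w | w. w \<in> constants m} =
    {dscale a (f + c) + w | c w. c \<in> constants m \<and> w \<in> constants m}"
  proof (intro equalityI subsetI)
    fix x
    assume "x \<in> {dscale a f + w | w. w \<in> constants m}"
    then obtain w where "w \<in> constants m" "x = dscale a (f + 0) + w"
      by auto
    then show "x \<in> {dscale a (f + c) + w | c w. c \<in> constants m \<and> w \<in> constants m}"
      using zero by blast
  next
    fix x
    assume "x \<in> {dscale a (f + c) + w | c w. c \<in> constants m \<and> w \<in> constants m}"
    then show "x \<in> {dscale a f + w | w. w \<in> constants m}"
      using closed distrib by blast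
  qed
  also have "\<dots> = {dscale a x + w | x w. x \<in> {f + c | c. c \<in> constants m} \<and> w \<in> constants m}"
    by blast
  finally show ?thesis
    by (simp only: po_to_ham_def ham_def lie_quotient_simps vcoset_def ops)
qed

lemma grade_reversal_ham2:
  "grade_reversal (ham2 m p :: ('a::field, 'a divpow set) graded_lie) ((`) (reversal m))"
proof -
  let ?H = "ham m p :: ('a, 'a divpow set) graded_lie"
  interpret H: grade_reversal ?H "(`) (reversal m)"
    by (rule grade_reversal_ham)
  define R where "R = {r \<in> truncated_indices (2 * m) p.
    0 < total_degree (2 * m) r \<and> total_degree (2 * m) r < 2 * m * (p - 1)}"
  have base: "reversal m ` X \<in> vspan ?H ((\<lambda>r. po_to_ham m p (dmonom r)) ` R)"
    if "X \<in> (\<lambda>r. po_to_ham m p (dmonom r)) ` R" for X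
  proof -
    obtain r where X: "X = po_to_ham m p (dmonom r)" and "r \<in> R"
      using \<open>X \<in> _\<close> by blast
    \<comment> \<open>Both the truncation and the bounds on the total degree are symmetric in the
      variables.\<close>
    then have "swap_multi_index m r \<in> R"
      by (simp add: R_def swap_in_truncated_indices total_degree_swap)
    then show ?thesis
      unfolding X reversal_po_to_ham reversal_dmonom po_to_ham_dscale
      by (intro vspan.scale vspan.base imageI)
  qed
  show ?thesis
    unfolding ham2_def R_def[symmetric] by (intro H.grade_reversal_lie_sub H.map_vspan[OF _ base])
qed

text \<open>The carrier is a preimage under the projection; equivariance turns its invariance into
  that of the carrier of \<open>ham2\<close>.\<close>

lemma grade_reversal_po2:
  "grade_reversal (po2 m p :: ('a::field, 'a divpow) graded_lie) (reversal m)"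
  unfolding po2_def
  by (rule grade_reversal.grade_reversal_lie_sub[OF grade_reversal_po])
    (auto intro: grade_reversal.carrier_closed[OF grade_reversal_po]
      grade_reversal.carrier_closed[OF grade_reversal_ham2] simp flip: reversal_po_to_ham)

theorem proposition1:
  fixes p m k :: nat and g :: int
  assumes "prime p"
    and "CHAR('a::field) = p"
    and "m \<ge> 1"
  shows "visomorphic (graded_cohomology (ham m p :: ('a, 'a divpow set) graded_lie) k g)
           (graded_cohomology (ham m p :: ('a, 'a divpow set) graded_lie) k (- g)) \<and>
         visomorphic (graded_cohomology (ham2 m p :: ('a, 'a divpow set) graded_lie) k g)
           (graded_cohomology (ham2 m p :: ('a, 'a divpow set) graded_lie) k (- g)) \<and>
         visomorphic (graded_cohomology (po m p :: ('a, 'a divpow) graded_lie) k g)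
           (graded_cohomology (po m p :: ('a, 'a divpow) graded_lie) k (- g)) \<and>
         visomorphic (graded_cohomology (po2 m p :: ('a, 'a divpow) graded_lie) k g)
           (graded_cohomology (po2 m p :: ('a, 'a divpow) graded_lie) k (- g))"
  \<comment> \<open>For the Poisson algebras the involution is \<open>reversal m\<close>; for the
    Hamiltonian ones, whose elements are cosets, it takes images under
    \<open>reversal m\<close>.\<close>
  using grade_reversal_ham[THEN grade_reversal.visomorphic_graded_cohomology]
    grade_reversal_ham2[THEN grade_reversal.visomorphic_graded_cohomology]
    grade_reversal_po[THEN grade_reversal.visomorphic_graded_cohomology]
    grade_reversal_po2[THEN grade_reversal.visomorphic_graded_cohomology]
  by (intro conjI)

end
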